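(* Let $\mathbf S$ be a specialization semilattice with $0$, and let $\widetilde{\mathbf S}=(\widetilde S,\vee,\sqsubseteq)$ and $\upsilon_{\mathbf S}:S\to\widetilde S$ be constructed from $\mathbf S$ as in the context. Then: (1) $\widetilde{\mathbf S}$ is a principal additive specialization semilattice with $0$. (2) $\upsilon_{\mathbf S}$ is a $0$-preserving embedding of $\mathbf S$ into $\widetilde{\mathbf S}$. (3) The pair $(\widetilde{\mathbf S},\upsilon_{\mathbf S})$ has the following universal property: for every principal additive specialization semilattice $\mathbf T$ and every homomorphism $\eta:\mathbf S\to\mathbf T$, there is a unique $K$-homomorphism $\widetilde\eta:\widetilde{\mathbf S}\to\mathbf T$ such that $\widetilde\eta(\upsilon_{\mathbf S}(a))=\eta(a)$ for every $a\in S$. (4) If $\mathbf U$ is another specialization semilattice with $0$ and $\psi:\mathbf S\to\mathbf U$ is a $0$-preserving homomorphism, then there is a unique $K$-homomorphism $\widetilde\psi:\widetilde{\mathbf S}\to\widetilde{\mathbf U}$ such that $\widetilde\psi(\upsilon_{\mathbf S}(a))=\upsilon_{\mathbf U}(\psi(a))$ for every $a\in S$ (where $\widetilde{\mathbf U}$ and $\upsilon_{\mathbf U}$ are constructed from $\mathbf U$ in the same way).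
   Context: A specialization semilattice is a triple $\mathbf S=(S,\vee,\sqsubseteq)$ where $(S,\vee)$ is a join semilattice with induced order $\le$ (i.e. $a\le b$ iff $a\vee b=b$), and $\sqsubseteq$ is a binary relation on $S$ satisfying, for all $a,b,c,a_1\in S$: (S1) $a\le b\Rightarrow a\sqsubseteq b$; (S2) $a\sqsubseteq b$ and $b\sqsubseteq c$ imply $a\sqsubseteq c$; (S3) $a\sqsubseteq b$ and $a_1\sqsubseteq b$ imply $a\vee a_1\sqsubseteq b$. A specialization semilattice with $0$ is a specialization semilattice with a constant $0$ which is neutral for $\vee$ and such that $a\sqsubseteq 0$ implies $a=0$. A homomorphism of specialization semilattices is a semilattice homomorphism $\eta$ such that $a\sqsubseteq b$ implies $\eta(a)\sqsubseteq\eta(b)$. A homomorphism of specialization semilattices with $0$ is required to satisfy $\eta(0)=0$; when this is to be mentioned explicitly, the homomorphism is called $0$-preserving. An embedding is an injective homomorphism such that moreover $\eta(a)\sqsubseteq\eta(b)$ implies $a\sqsubseteq b$. In a specialization semilattice, if the set $\{b\in S\mid b\sqsubseteq a\}$ has a $\le$-maximum, this maximum is denoted $Ka$ (the closure of $a$). The specialization semilattice is principal if $Ka$ exists for every $a\in S$. A principal specialization semilattice is additive if $K(a\vee b)=Ka\vee Kb$ for all $a,b$. A $K$-homomorphism between principal specialization semilattices is a homomorphism $\eta$ with $\eta(Ka)=K\eta(a)$ for all $a$. Construction of $\widetilde{\mathbf S}$. On $S\times S$ define $(a,b)\sim(c,d)$ if and only if $b\sqsubseteq d$, $d\sqsubseteq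 b$, and there are $a_1,c_1\in S$ such that $a_1\sqsubseteq b$, $c_1\sqsubseteq d$, $a\le c\vee c_1$ and $c\le a\vee a_1$. This is an equivalence relation and a congruence of the product semilattice $(S,\vee)\times(S,\vee)$. Let $\widetilde S=(S\times S)/{\sim}$, let $[a,b]$ be the $\sim$-class of $(a,b)$, and let $\vee$ on $\widetilde S$ be the quotient operation, $[a,b]\vee[c,d]=[a\vee c,b\vee d]$, with induced order $\le$. Define $K:\widetilde S\to\widetilde S$ by $K[a,b]=[a,a\vee b]$ (this is well defined), and define $\sqsubseteq$ on $\widetilde S$ by: $[a,b]\sqsubseteq[c,d]$ iff $[a,b]\le K[c,d]$. Put $\widetilde{\mathbf S}=(\widetilde S,\vee,\sqsubseteq)$; its $0$ is the class $[0,0]$. Define $\upsilon_{\mathbf S}:S\to\widetilde S$ by $\upsilon_{\mathbf S}(a)=[a,0]$.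
   Formalization: In (3), T is taken to be a principal additive specialization semilattice with 0 and η to be 0-preserving; without this (3) fails, e.g. S={0}, T={0<1} with 1⊑0 and η(0)=0, where K0=1. *)

theory Defs
  imports "HOL-Algebra.Congruence"
begin

record 'a spec_struct = "'a partial_object" +
  join :: "'a \<Rightarrow> 'a \<Rightarrow> 'a" (infixl "\<squnion>\<index>" 65)
  spec :: "'a \<Rightarrow> 'a \<Rightarrow> bool" (infix "\<sqsubseteq>\<index>" 50)

record 'a spec_struct0 = "'a spec_struct" +
  zero :: 'a ("\<zero>\<index>")

definition le :: "('a, 'm) spec_struct_scheme \<Rightarrow> 'a \<Rightarrow> 'a \<Rightarrow> bool" (infix "\<preceq>\<index>" 50)
  where "a \<preceq>\<^bsub>S\<^esub> b \<longleftrightarrow> a \<squnion>\<^bsub>S\<^esub> b = b"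

locale spec_semilattice =
  fixes S (structure)
  assumes join_closed: "\<lbrakk>a \<in> carrier S; b \<in> carrier S\<rbrakk> \<Longrightarrow> a \<squnion> b \<in> carrier S"
    and join_assoc: "\<lbrakk>a \<in> carrier S; b \<in> carrier S; c \<in> carrier S\<rbrakk>
      \<Longrightarrow> (a \<squnion> b) \<squnion> c = a \<squnion> (b \<squnion> c)"
    and join_comm: "\<lbrakk>a \<in> carrier S; b \<in> carrier S\<rbrakk> \<Longrightarrow> a \<squnion> b = b \<squnion> a"
    and join_idem: "a \<in> carrier S \<Longrightarrow> a \<squnion> a = a"
    and S1: "\<lbrakk>a \<in> carrier S; b \<in> carrier S; a \<preceq> b\<rbrakk> \<Longrightarrow> a \<sqsubseteq> b"
    and S2: "\<lbrakk>a \<in> carrier S; b \<in> carrier S; c \<in> carrier S; a \<sqsubseteq> b; b \<sqsubseteq> c\<rbrakk> \<Longrightarrow> a \<sqsubseteq> c"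
    and S3: "\<lbrakk>a \<in> carrier S; b \<in> carrier S; a\<^sub>1 \<in> carrier S; a \<sqsubseteq> b; a\<^sub>1 \<sqsubseteq> b\<rbrakk>
      \<Longrightarrow> a \<squnion> a\<^sub>1 \<sqsubseteq> b"

locale spec_semilattice0 = spec_semilattice +
  assumes zero_closed: "\<zero> \<in> carrier S"
    and zero_neutral: "a \<in> carrier S \<Longrightarrow> \<zero> \<squnion> a = a"
    and spec_zero: "\<lbrakk>a \<in> carrier S; a \<sqsubseteq> \<zero>\<rbrakk> \<Longrightarrow> a = \<zero>"

definition is_closure :: "('a, 'm) spec_struct_scheme \<Rightarrow> 'a \<Rightarrow> 'a \<Rightarrow> bool" where
  "is_closure S a m \<longleftrightarrow>
     m \<in> {b \<in> carrier S. b \<sqsubseteq>\<^bsub>S\<^esub> a} \<and> (\<forall>b \<in> {b \<in> carrier S. b \<sqsubseteq>\<^bsub>S\<^esub> a}. b \<preceq>\<^bsub>S\<^esub> m)"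

definition K :: "('a, 'm) spec_struct_scheme \<Rightarrow> 'a \<Rightarrow> 'a" where
  "K S a = (THE m. is_closure S a m)"

definition spec_principal :: "('a, 'm) spec_struct_scheme \<Rightarrow> bool" where
  "spec_principal S \<longleftrightarrow> (\<forall>a \<in> carrier S. \<exists>m. is_closure S a m)"

definition spec_additive :: "('a, 'm) spec_struct_scheme \<Rightarrow> bool" where
  "spec_additive S \<longleftrightarrow> (\<forall>a \<in> carrier S. \<forall>b \<in> carrier S. K S (a \<squnion>\<^bsub>S\<^esub> b) = K S a \<squnion>\<^bsub>S\<^esub> K S b)"

lemma (in spec_semilattice) K_eqI:
  assumes "is_closure S a m"
  shows "K S a = m"
proof -
  have "x = m" if "is_closure S a x" for x
    using that assms join_comm[of x m] unfolding is_closure_def le_def by auto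
  with assms show ?thesis
    unfolding K_def by blast
qed

text \<open>Maps are constrained on the carrier only; \<open>extensional\<close> is added where uniqueness is stated.\<close>

definition spec_hom ::
    "('a, 'm) spec_struct_scheme \<Rightarrow> ('b, 'n) spec_struct_scheme \<Rightarrow> ('a \<Rightarrow> 'b) set" where
  "spec_hom S T = {h \<in> carrier S \<rightarrow> carrier T.
     (\<forall>a \<in> carrier S. \<forall>b \<in> carrier S. h (a \<squnion>\<^bsub>S\<^esub> b) = h a \<squnion>\<^bsub>T\<^esub> h b) \<and>
     (\<forall>a \<in> carrier S. \<forall>b \<in> carrier S. a \<sqsubseteq>\<^bsub>S\<^esub> b \<longrightarrow> h a \<sqsubseteq>\<^bsub>T\<^esub> h b)}"

definition spec_hom0 ::
    "('a, 'm) spec_struct0_scheme \<Rightarrow> ('b, 'n) spec_struct0_scheme \<Rightarrow> ('a \<Rightarrow> 'b) set" where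
  "spec_hom0 S T = {h \<in> spec_hom S T. h \<zero>\<^bsub>S\<^esub> = \<zero>\<^bsub>T\<^esub>}"

definition spec_embedding ::
    "('a, 'm) spec_struct_scheme \<Rightarrow> ('b, 'n) spec_struct_scheme \<Rightarrow> ('a \<Rightarrow> 'b) set" where
  "spec_embedding S T = {h \<in> spec_hom S T. inj_on h (carrier S) \<and>
     (\<forall>a \<in> carrier S. \<forall>b \<in> carrier S. h a \<sqsubseteq>\<^bsub>T\<^esub> h b \<longrightarrow> a \<sqsubseteq>\<^bsub>S\<^esub> b)}"

definition K_hom ::
    "('a, 'm) spec_struct_scheme \<Rightarrow> ('b, 'n) spec_struct_scheme \<Rightarrow> ('a \<Rightarrow> 'b) set" where
  "K_hom S T = {h \<in> spec_hom S T. \<forall>a \<in> carrier S. h (K S a) = K T (h a)}"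

definition tilde_rel ::
    "('a, 'm) spec_struct_scheme \<Rightarrow> (('a \<times> 'a) \<times> ('a \<times> 'a)) set" where
  "tilde_rel S = {((a, b), (c, d)).
     a \<in> carrier S \<and> b \<in> carrier S \<and> c \<in> carrier S \<and> d \<in> carrier S \<and>
     b \<sqsubseteq>\<^bsub>S\<^esub> d \<and> d \<sqsubseteq>\<^bsub>S\<^esub> b \<and>
     (\<exists>a\<^sub>1 \<in> carrier S. \<exists>c\<^sub>1 \<in> carrier S. a\<^sub>1 \<sqsubseteq>\<^bsub>S\<^esub> b \<and> c\<^sub>1 \<sqsubseteq>\<^bsub>S\<^esub> d \<and>
        a \<preceq>\<^bsub>S\<^esub> c \<squnion>\<^bsub>S\<^esub> c\<^sub>1 \<and> c \<preceq>\<^bsub>S\<^esub> a \<squnion>\<^bsub>S\<^esub> a\<^sub>1)}"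

definition tilde_class :: "('a, 'm) spec_struct_scheme \<Rightarrow> 'a \<Rightarrow> 'a \<Rightarrow> ('a \<times> 'a) set" where
  "tilde_class S a b = tilde_rel S `` {(a, b)}"

definition tilde_join ::
    "('a, 'm) spec_struct_scheme \<Rightarrow> ('a \<times> 'a) set \<Rightarrow> ('a \<times> 'a) set \<Rightarrow> ('a \<times> 'a) set" where
  "tilde_join S X Y =
     the_elem (\<Union>(a, b) \<in> X. \<Union>(c, d) \<in> Y. {tilde_class S (a \<squnion>\<^bsub>S\<^esub> c) (b \<squnion>\<^bsub>S\<^esub> d)})"

definition tilde_K :: "('a, 'm) spec_struct_scheme \<Rightarrow> ('a \<times> 'a) set \<Rightarrow> ('a \<times> 'a) set" where
  "tilde_K S X = the_elem (\<Union>(a, b) \<in> X. {tilde_class S a (a \<squnion>\<^bsub>S\<^esub> b)})"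

text \<open>In the specialization below, \<open>tilde_join S X (tilde_K S Y) = tilde_K S Y\<close> says
  \<open>X \<preceq> tilde_K S Y\<close> in the order induced by \<open>tilde_join\<close>.\<close>

definition tilde :: "('a, 'm) spec_struct0_scheme \<Rightarrow> ('a \<times> 'a) set spec_struct0" where
  "tilde S = \<lparr>
     carrier = (carrier S \<times> carrier S) // tilde_rel S,
     join = tilde_join S,
     spec = (\<lambda>X Y. tilde_join S X (tilde_K S Y) = tilde_K S Y),
     zero = tilde_class S \<zero>\<^bsub>S\<^esub> \<zero>\<^bsub>S\<^esub>\<rparr>"

definition upsilon :: "('a, 'm) spec_struct0_scheme \<Rightarrow> 'a \<Rightarrow> ('a \<times> 'a) set" where
  "upsilon S a = tilde_class S a \<zero>\<^bsub>S\<^esub>"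

context spec_semilattice
begin

lemma le_refl: "a \<in> carrier S \<Longrightarrow> a \<preceq> a"
  by (simp add: le_def join_idem)

lemma le_trans: "\<lbrakk>a \<preceq> b; b \<preceq> c; a \<in> carrier S; b \<in> carrier S; c \<in> carrier S\<rbrakk> \<Longrightarrow> a \<preceq> c"
  by (metis le_def join_assoc)

lemma le_join1: "\<lbrakk>a \<in> carrier S; b \<in> carrier S\<rbrakk> \<Longrightarrow> a \<preceq> a \<squnion> b"
  by (metis le_def join_assoc join_idem)

lemma le_join2: "\<lbrakk>a \<in> carrier S; b \<in> carrier S\<rbrakk> \<Longrightarrow> b \<preceq> a \<squnion> b"
  by (metis le_join1 join_comm)

lemma join_lub:
  "\<lbrakk>a \<preceq> c; b \<preceq> c; a \<in> carrier S; b \<in> carrier S; c \<in> carrier S\<rbrakk> \<Longrightarrow> a \<squnion> b \<preceq> c"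
  by (metis le_def join_assoc)

lemma join_mono:
  assumes "a \<preceq> c" "b \<preceq> d" "a \<in> carrier S" "b \<in> carrier S" "c \<in> carrier S" "d \<in> carrier S"
  shows "a \<squnion> b \<preceq> c \<squnion> d"
  using assms by (meson join_lub le_join1 le_join2 le_trans join_closed)

lemma spec_refl: "a \<in> carrier S \<Longrightarrow> a \<sqsubseteq> a"
  by (simp add: S1 le_refl)

lemma join_spec_mono:
  assumes "a \<sqsubseteq> c" "b \<sqsubseteq> d" "a \<in> carrier S" "b \<in> carrier S" "c \<in> carrier S" "d \<in> carrier S"
  shows "a \<squnion> b \<sqsubseteq> c \<squnion> d"
  using assms by (meson S1 S2 S3 le_join1 le_join2 join_closed)

lemma join_swap:
  "\<lbrakk>a \<in> carrier S; b \<in> carrier S; c \<in> carrier S; d \<in> carrier S\<rbrakk>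
    \<Longrightarrow> (a \<squnion> b) \<squnion> (c \<squnion> d) = (a \<squnion> c) \<squnion> (b \<squnion> d)"
  by (simp add: join_assoc join_closed) (simp add: join_assoc[symmetric] join_comm[of b c])

lemma tilde_half_trans:
  assumes "a \<preceq> c \<squnion> c\<^sub>1" "c\<^sub>1 \<sqsubseteq> d" "c \<preceq> e \<squnion> e\<^sub>1" "e\<^sub>1 \<sqsubseteq> f" "d \<sqsubseteq> f"
    and "a \<in> carrier S" "c \<in> carrier S" "c\<^sub>1 \<in> carrier S" "d \<in> carrier S" "e \<in> carrier S"
      "e\<^sub>1 \<in> carrier S" "f \<in> carrier S"
  shows "\<exists>x \<in> carrier S. x \<sqsubseteq> f \<and> a \<preceq> e \<squnion> x"
proof (intro bexI conjI)
  show "e\<^sub>1 \<squnion> c\<^sub>1 \<sqsubseteq> f"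
    using assms by (meson S2 S3)
  have "a \<preceq> (e \<squnion> e\<^sub>1) \<squnion> c\<^sub>1"
    using assms by (meson join_mono le_refl le_trans join_closed)
  then show "a \<preceq> e \<squnion> (e\<^sub>1 \<squnion> c\<^sub>1)"
    using assms by (simp add: join_assoc)
  show "e\<^sub>1 \<squnion> c\<^sub>1 \<in> carrier S"
    using assms by (simp add: join_closed)
qed

lemma equiv_tilde_rel: "equiv (carrier S \<times> carrier S) (tilde_rel S)"
proof (rule equivI)
  show "tilde_rel S \<subseteq> (carrier S \<times> carrier S) \<times> (carrier S \<times> carrier S)"
    by (auto simp: tilde_rel_def)
  show "refl_on (carrier S \<times> carrier S) (tilde_rel S)"
    unfolding refl_on_def tilde_rel_def using spec_refl le_join1 by auto
  show "sym (tilde_rel S)"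
    unfolding sym_def tilde_rel_def by auto
  show "trans (tilde_rel S)"
  proof (rule transI, clarify)
    fix a b c d e f
    assume 1: "((a, b), (c, d)) \<in> tilde_rel S" and 2: "((c, d), (e, f)) \<in> tilde_rel S"
    from 1 obtain a1 c1 where 3: "a1 \<in> carrier S" "c1 \<in> carrier S" "a1 \<sqsubseteq> b" "c1 \<sqsubseteq> d"
      "a \<preceq> c \<squnion> c1" "c \<preceq> a \<squnion> a1" and C1: "a \<in> carrier S" "b \<in> carrier S" "c \<in> carrier S"
      "d \<in> carrier S" "b \<sqsubseteq> d" "d \<sqsubseteq> b"
      unfolding tilde_rel_def by auto
    from 2 obtain c2 e1 where 4: "c2 \<in> carrier S" "e1 \<in> carrier S" "c2 \<sqsubseteq> d" "e1 \<sqsubseteq> f"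
      "c \<preceq> e \<squnion> e1" "e \<preceq> c \<squnion> c2" and C2: "e \<in> carrier S" "f \<in> carrier S" "d \<sqsubseteq> f" "f \<sqsubseteq> d"
      unfolding tilde_rel_def by auto
    have "\<exists>x \<in> carrier S. x \<sqsubseteq> f \<and> a \<preceq> e \<squnion> x"
      by (rule tilde_half_trans[of a c c1 d e e1 f]) (use 3 4 C1 C2 in auto)
    moreover have "\<exists>x \<in> carrier S. x \<sqsubseteq> b \<and> e \<preceq> a \<squnion> x"
      by (rule tilde_half_trans[of e c c2 d a a1 b]) (use 3 4 C1 C2 in auto)
    moreover have "b \<sqsubseteq> f" "f \<sqsubseteq> b"
      using C1 C2 S2 by blast+
    ultimately show "((a, b), (e, f)) \<in> tilde_rel S"
      using C1 C2 unfolding tilde_rel_def by blast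
  qed
qed

lemma tilde_join_half:
  assumes "a \<preceq> c \<squnion> c\<^sub>1" "c\<^sub>1 \<sqsubseteq> d" "a' \<preceq> c' \<squnion> c\<^sub>1'" "c\<^sub>1' \<sqsubseteq> d'"
    and "a \<in> carrier S" "c \<in> carrier S" "c\<^sub>1 \<in> carrier S" "d \<in> carrier S"
      "a' \<in> carrier S" "c' \<in> carrier S" "c\<^sub>1' \<in> carrier S" "d' \<in> carrier S"
  shows "\<exists>x \<in> carrier S. x \<sqsubseteq> d \<squnion> d' \<and> a \<squnion> a' \<preceq> (c \<squnion> c') \<squnion> x"
proof (intro bexI conjI)
  show "c\<^sub>1 \<squnion> c\<^sub>1' \<sqsubseteq> d \<squnion> d'"
    using assms by (simp add: join_spec_mono)
  have "a \<squnion> a' \<preceq> (c \<squnion> c\<^sub>1) \<squnion> (c' \<squnion> c\<^sub>1')"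
    using assms by (simp add: join_mono join_closed)
  then show "a \<squnion> a' \<preceq> (c \<squnion> c') \<squnion> (c\<^sub>1 \<squnion> c\<^sub>1')"
    using assms join_swap by simp
  show "c\<^sub>1 \<squnion> c\<^sub>1' \<in> carrier S"
    using assms by (simp add: join_closed)
qed

lemma tilde_rel_join:
  assumes "((a, b), (c, d)) \<in> tilde_rel S" "((a', b'), (c', d')) \<in> tilde_rel S"
  shows "((a \<squnion> a', b \<squnion> b'), (c \<squnion> c', d \<squnion> d')) \<in> tilde_rel S"
proof -
  from assms(1) obtain a1 c1 where 1: "a1 \<in> carrier S" "c1 \<in> carrier S" "a1 \<sqsubseteq> b" "c1 \<sqsubseteq> d"
    "a \<preceq> c \<squnion> c1" "c \<preceq> a \<squnion> a1" "a \<in> carrier S" "b \<in> carrier S" "c \<in> carrier S"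
    "d \<in> carrier S" "b \<sqsubseteq> d" "d \<sqsubseteq> b"
    unfolding tilde_rel_def by auto
  from assms(2) obtain a2 c2 where 2: "a2 \<in> carrier S" "c2 \<in> carrier S" "a2 \<sqsubseteq> b'" "c2 \<sqsubseteq> d'"
    "a' \<preceq> c' \<squnion> c2" "c' \<preceq> a' \<squnion> a2" "a' \<in> carrier S" "b' \<in> carrier S" "c' \<in> carrier S"
    "d' \<in> carrier S" "b' \<sqsubseteq> d'" "d' \<sqsubseteq> b'"
    unfolding tilde_rel_def by auto
  have "\<exists>x \<in> carrier S. x \<sqsubseteq> d \<squnion> d' \<and> a \<squnion> a' \<preceq> (c \<squnion> c') \<squnion> x"
    by (rule tilde_join_half[of a c c1 d a' c' c2 d']) (use 1 2 in auto)
  moreover have "\<exists>x \<in> carrier S. x \<sqsubseteq> b \<squnion> b' \<and> c \<squnion> c' \<preceq> (a \<squnion> a') \<squnion> x"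
    by (rule tilde_join_half[of c a a1 b c' a' a2 b']) (use 1 2 in auto)
  moreover have "b \<squnion> b' \<sqsubseteq> d \<squnion> d'" "d \<squnion> d' \<sqsubseteq> b \<squnion> b'"
    using 1 2 by (auto intro: join_spec_mono)
  ultimately show ?thesis
    using 1 2 join_closed unfolding tilde_rel_def by blast
qed

lemma tilde_rel_K:
  assumes "((a, b), (c, d)) \<in> tilde_rel S"
  shows "((a, a \<squnion> b), (c, c \<squnion> d)) \<in> tilde_rel S"
proof -
  from assms obtain a1 c1 where 1: "a1 \<in> carrier S" "c1 \<in> carrier S" "a1 \<sqsubseteq> b" "c1 \<sqsubseteq> d"
    "a \<preceq> c \<squnion> c1" "c \<preceq> a \<squnion> a1" "a \<in> carrier S" "b \<in> carrier S" "c \<in> carrier S"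
    "d \<in> carrier S" "b \<sqsubseteq> d" "d \<sqsubseteq> b"
    unfolding tilde_rel_def by auto
  have cl: "a \<squnion> b \<in> carrier S" "c \<squnion> d \<in> carrier S" "c \<squnion> c1 \<in> carrier S" "a \<squnion> a1 \<in> carrier S"
    using 1 join_closed by auto
  have up: "b \<sqsubseteq> a \<squnion> b" "d \<sqsubseteq> c \<squnion> d"
    using 1 cl by (simp_all add: S1 le_join2)
  have "c \<squnion> c1 \<sqsubseteq> c \<squnion> d" "a \<squnion> a1 \<sqsubseteq> a \<squnion> b"
    using 1 by (simp_all add: join_spec_mono spec_refl)
  then have "a \<sqsubseteq> c \<squnion> d" "c \<sqsubseteq> a \<squnion> b"
    using S2[OF _ _ _ S1[of a "c \<squnion> c1"]] S2[OF _ _ _ S1[of c "a \<squnion> a1"]] 1 cl by simp_all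
  moreover have "b \<sqsubseteq> c \<squnion> d" "d \<sqsubseteq> a \<squnion> b"
    using S2[of b d "c \<squnion> d"] S2[of d b "a \<squnion> b"] 1 cl up by simp_all
  ultimately have "a \<squnion> b \<sqsubseteq> c \<squnion> d" "c \<squnion> d \<sqsubseteq> a \<squnion> b"
    using 1 cl by (simp_all add: S3)
  moreover have "a1 \<sqsubseteq> a \<squnion> b" "c1 \<sqsubseteq> c \<squnion> d"
    using S2[of a1 b "a \<squnion> b"] S2[of c1 d "c \<squnion> d"] 1 cl up by simp_all
  ultimately show ?thesis
    using 1 cl unfolding tilde_rel_def by auto
qed

lemma tilde_class_self: "\<lbrakk>a \<in> carrier S; b \<in> carrier S\<rbrakk> \<Longrightarrow> (a, b) \<in> tilde_class S a b"
  unfolding tilde_class_def using equiv_class_self[OF equiv_tilde_rel] by blast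

lemma tilde_class_eq_iff:
  assumes "a \<in> carrier S" "b \<in> carrier S" "c \<in> carrier S" "d \<in> carrier S"
  shows "tilde_class S a b = tilde_class S c d \<longleftrightarrow> ((a, b), (c, d)) \<in> tilde_rel S"
  unfolding tilde_class_def using eq_equiv_class_iff[OF equiv_tilde_rel] assms by simp

lemma tilde_class_rel: "p \<in> tilde_class S a b \<Longrightarrow> ((a, b), (fst p, snd p)) \<in> tilde_rel S"
  unfolding tilde_class_def by simp

lemma tilde_rel_class_eq:
  "((a, b), (c, d)) \<in> tilde_rel S \<Longrightarrow> tilde_class S c d = tilde_class S a b"
  unfolding tilde_class_def using equiv_class_eq[OF equiv_tilde_rel] by metis

lemma tilde_join_class:
  assumes "a \<in> carrier S" "b \<in> carrier S" "c \<in> carrier S" "d \<in> carrier S"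
  shows "tilde_join S (tilde_class S a b) (tilde_class S c d) = tilde_class S (a \<squnion> c) (b \<squnion> d)"
proof -
  let ?R = "tilde_class S (a \<squnion> c) (b \<squnion> d)"
  have ne: "tilde_class S a b \<noteq> {}" "tilde_class S c d \<noteq> {}"
    using tilde_class_self assms by blast+
  have "tilde_class S (fst p \<squnion> fst q) (snd p \<squnion> snd q) = ?R"
    if "p \<in> tilde_class S a b" "q \<in> tilde_class S c d" for p q
    by (rule tilde_rel_class_eq, rule tilde_rel_join) (use that tilde_class_rel in simp_all)
  then have "(\<Union>p \<in> tilde_class S a b. \<Union>q \<in> tilde_class S c d.
      {tilde_class S (fst p \<squnion> fst q) (snd p \<squnion> snd q)}) = {?R}"
    using ne by simp
  then show ?thesis
    by (simp add: tilde_join_def case_prod_unfold)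
qed

lemma tilde_K_class:
  assumes "a \<in> carrier S" "b \<in> carrier S"
  shows "tilde_K S (tilde_class S a b) = tilde_class S a (a \<squnion> b)"
proof -
  let ?R = "tilde_class S a (a \<squnion> b)"
  have ne: "tilde_class S a b \<noteq> {}"
    using tilde_class_self assms by blast
  have "tilde_class S (fst p) (fst p \<squnion> snd p) = ?R" if "p \<in> tilde_class S a b" for p
    by (rule tilde_rel_class_eq, rule tilde_rel_K) (use that tilde_class_rel in simp)
  then have "(\<Union>p \<in> tilde_class S a b. {tilde_class S (fst p) (fst p \<squnion> snd p)}) = {?R}"
    using ne by simp
  then show ?thesis
    by (simp add: tilde_K_def case_prod_unfold)
qed

end

end

theory Submission
  imports Defs
begin

text \<open>The class \<open>[a, b]\<close> stands for a formal element \<open>a \<squnion> K b\<close>: indeed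
  \<open>[a, b] = \<upsilon>(a) \<squnion> K(\<upsilon>(b))\<close>. A \<open>K\<close>-homomorphism extending \<open>\<eta>\<close> is thus forced to send \<open>[a, b]\<close> to
  \<open>\<eta>(a) \<squnion> K(\<eta>(b))\<close>. This is well defined because \<open>\<eta>\<close> preserves \<open>\<sqsubseteq>\<close>, and additivity of the
  target makes it a \<open>K\<close>-homomorphism. Part (4) is the universal property applied to \<open>\<upsilon>\<^sub>U \<circ> \<psi>\<close>.\<close>

section \<open>Homomorphisms, and closure in principal semilattices\<close>

lemma spec_homD:
  assumes "h \<in> spec_hom S T"
  shows "a \<in> carrier S \<Longrightarrow> h a \<in> carrier T"
    and "\<lbrakk>a \<in> carrier S; b \<in> carrier S\<rbrakk> \<Longrightarrow> h (a \<squnion>\<^bsub>S\<^esub> b) = h a \<squnion>\<^bsub>T\<^esub> h b"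
    and "\<lbrakk>a \<in> carrier S; b \<in> carrier S; a \<sqsubseteq>\<^bsub>S\<^esub> b\<rbrakk> \<Longrightarrow> h a \<sqsubseteq>\<^bsub>T\<^esub> h b"
    and "\<lbrakk>a \<in> carrier S; b \<in> carrier S; a \<preceq>\<^bsub>S\<^esub> b\<rbrakk> \<Longrightarrow> h a \<preceq>\<^bsub>T\<^esub> h b"
  using assms by (auto simp: spec_hom_def le_def) metis

lemma spec_hom_comp:
  assumes "g \<in> spec_hom S T" "h \<in> spec_hom T U"
  shows "(\<lambda>a. h (g a)) \<in> spec_hom S U"
  using assms by (auto simp: spec_hom_def Pi_iff)

lemma (in spec_semilattice) le_antisym:
  "\<lbrakk>a \<preceq> b; b \<preceq> a; a \<in> carrier S; b \<in> carrier S\<rbrakk> \<Longrightarrow> a = b"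
  by (metis le_def join_comm)

locale principal_spec_semilattice = spec_semilattice +
  assumes principal: "spec_principal S"
begin

lemma is_closure_K:
  assumes "a \<in> carrier S"
  shows "is_closure S a (K S a)"
  using assms principal K_eqI unfolding spec_principal_def by metis

lemma K_closed: "a \<in> carrier S \<Longrightarrow> K S a \<in> carrier S"
  and K_spec: "a \<in> carrier S \<Longrightarrow> K S a \<sqsubseteq> a"
  using is_closure_K unfolding is_closure_def by auto

text \<open>Recovers \<sqsubseteq> from the order and \<open>K\<close>, so that later claims about
  \<sqsubseteq> become inequalities. Maximality of the closure gives one direction,
  \<open>K_spec\<close> with S1 and S2 the other.\<close>

lemma spec_iff_le_K:
  assumes "a \<in> carrier S" "b \<in> carrier S"
  shows "a \<sqsubseteq> b \<longleftrightarrow> a \<preceq> K S b"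
proof
  assume "a \<sqsubseteq> b"
  then show "a \<preceq> K S b"
    using assms is_closure_K[of b] unfolding is_closure_def by auto
next
  assume "a \<preceq> K S b"
  then show "a \<sqsubseteq> b"
    using assms K_closed K_spec S1 S2 by blast
qed

lemma le_K: "a \<in> carrier S \<Longrightarrow> a \<preceq> K S a"
  using spec_iff_le_K spec_refl by blast

text \<open>The hypothesis is \<sqsubseteq>, weaker than the order: \<open>K S a\<close>
  \<sqsubseteq> \<open>a\<close> \<sqsubseteq> \<open>b\<close> already puts \<open>K S a\<close>
  among the elements whose maximum is \<open>K S b\<close>. The lift needs this form, since
  representatives are compared by \<sqsubseteq> in the second component.\<close>

lemma K_mono:
  assumes "a \<sqsubseteq> b" "a \<in> carrier S" "b \<in> carrier S"
  shows "K S a \<preceq> K S b"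
  using assms K_closed K_spec S2 spec_iff_le_K by meson

lemma K_K: "a \<in> carrier S \<Longrightarrow> K S (K S a) = K S a"
  by (meson K_closed K_mono K_spec le_K le_antisym)

end

section \<open>The quotient \<open>tilde S\<close> as a principal additive semilattice with
  zero\<close>

context spec_semilattice0
begin

lemma join_zero: "a \<in> carrier S \<Longrightarrow> a \<squnion> \<zero> = a"
  using join_comm zero_closed zero_neutral by metis

lemma K_zero: "K S \<zero> = \<zero>"
  by (rule K_eqI) (auto simp: is_closure_def zero_closed spec_refl le_refl dest: spec_zero)

lemma tilde_class_in_carrier:
  "\<lbrakk>a \<in> carrier S; b \<in> carrier S\<rbrakk> \<Longrightarrow> tilde_class S a b \<in> carrier (tilde S)"
  by (simp add: tilde_def tilde_class_def quotientI)

text \<open>Choosing representatives reduces the laws of the quotient to componentwise laws of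
  \<open>S\<close>, because join and \<open>tilde_K\<close> are computed on representatives.\<close>

lemma tilde_carrierE:
  assumes "X \<in> carrier (tilde S)"
  obtains a b where "X = tilde_class S a b" "a \<in> carrier S" "b \<in> carrier S"
  using assms unfolding tilde_def tilde_class_def by (auto elim!: quotientE)

lemma tilde_join_eq [simp]:
  "\<lbrakk>a \<in> carrier S; b \<in> carrier S; c \<in> carrier S; d \<in> carrier S\<rbrakk>
    \<Longrightarrow> tilde_class S a b \<squnion>\<^bsub>tilde S\<^esub> tilde_class S c d = tilde_class S (a \<squnion> c) (b \<squnion> d)"
  by (simp add: tilde_def tilde_join_class)

lemma tilde_zero: "\<zero>\<^bsub>tilde S\<^esub> = tilde_class S \<zero> \<zero>"
  by (simp add: tilde_def)

lemma tilde_spec: "X \<sqsubseteq>\<^bsub>tilde S\<^esub> Y \<longleftrightarrow> X \<preceq>\<^bsub>tilde S\<^esub> tilde_K S Y"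
  by (simp add: tilde_def le_def)

lemma join_left_idem: "\<lbrakk>a \<in> carrier S; b \<in> carrier S\<rbrakk> \<Longrightarrow> a \<squnion> (a \<squnion> b) = a \<squnion> b"
  by (metis join_assoc join_idem)

lemma tilde_join_closed:
  "\<lbrakk>X \<in> carrier (tilde S); Y \<in> carrier (tilde S)\<rbrakk> \<Longrightarrow> X \<squnion>\<^bsub>tilde S\<^esub> Y \<in> carrier (tilde S)"
  by (auto elim!: tilde_carrierE simp: tilde_class_in_carrier join_closed)

lemma tilde_join_assoc:
  "\<lbrakk>X \<in> carrier (tilde S); Y \<in> carrier (tilde S); Z \<in> carrier (tilde S)\<rbrakk>
    \<Longrightarrow> (X \<squnion>\<^bsub>tilde S\<^esub> Y) \<squnion>\<^bsub>tilde S\<^esub> Z = X \<squnion>\<^bsub>tilde S\<^esub> (Y \<squnion>\<^bsub>tilde S\<^esub> Z)"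
  by (auto elim!: tilde_carrierE simp: join_closed join_assoc)

lemma tilde_join_comm:
  "\<lbrakk>X \<in> carrier (tilde S); Y \<in> carrier (tilde S)\<rbrakk> \<Longrightarrow> X \<squnion>\<^bsub>tilde S\<^esub> Y = Y \<squnion>\<^bsub>tilde S\<^esub> X"
  by (elim tilde_carrierE) (simp, metis join_comm)

lemma tilde_join_idem: "X \<in> carrier (tilde S) \<Longrightarrow> X \<squnion>\<^bsub>tilde S\<^esub> X = X"
  by (auto elim!: tilde_carrierE simp: join_idem)

lemma tilde_K_closed: "X \<in> carrier (tilde S) \<Longrightarrow> tilde_K S X \<in> carrier (tilde S)"
  by (auto elim!: tilde_carrierE simp: tilde_class_in_carrier tilde_K_class join_closed)

lemma tilde_K_idem: "X \<in> carrier (tilde S) \<Longrightarrow> tilde_K S (tilde_K S X) = tilde_K S X"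
  by (auto elim!: tilde_carrierE simp: tilde_K_class join_closed join_left_idem)

text \<open>For \<open>[a, b]\<close> and \<open>[c, d]\<close> both sides have first component
  \<open>a \<squnion> c\<close>, and the second components
  \<open>(a \<squnion> c) \<squnion> (b \<squnion> d)\<close> and
  \<open>(a \<squnion> b) \<squnion> (c \<squnion> d)\<close> agree by rearrangement. This yields
  monotonicity of \<open>tilde_K\<close> as well as additivity.\<close>

lemma tilde_K_join:
  "\<lbrakk>X \<in> carrier (tilde S); Y \<in> carrier (tilde S)\<rbrakk>
    \<Longrightarrow> tilde_K S (X \<squnion>\<^bsub>tilde S\<^esub> Y) = tilde_K S X \<squnion>\<^bsub>tilde S\<^esub> tilde_K S Y"
  by (auto elim!: tilde_carrierE simp: tilde_K_class join_closed join_swap)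

lemma join_tilde_K: "X \<in> carrier (tilde S) \<Longrightarrow> X \<squnion>\<^bsub>tilde S\<^esub> tilde_K S X = tilde_K S X"
proof (elim tilde_carrierE)
  fix a b assume X: "X = tilde_class S a b" and ab: "a \<in> carrier S" "b \<in> carrier S"
  \<comment> \<open>The left side is the second component of
    \<open>[a, b] \<squnion> [a, a \<squnion> b]\<close>.\<close>
  have "b \<squnion> (a \<squnion> b) = a \<squnion> b"
    using ab le_join2 by (simp add: le_def)
  then show ?thesis
    using X ab by (simp add: tilde_K_class join_closed join_idem)
qed

lemma tilde_K_mono:
  assumes "X \<in> carrier (tilde S)" "Y \<in> carrier (tilde S)" "X \<preceq>\<^bsub>tilde S\<^esub> Y"
  shows "tilde_K S X \<preceq>\<^bsub>tilde S\<^esub> tilde_K S Y"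
  using assms tilde_K_join unfolding le_def by metis

lemma tilde_le_trans:
  assumes "X \<preceq>\<^bsub>tilde S\<^esub> Y" "Y \<preceq>\<^bsub>tilde S\<^esub> Z"
    and "X \<in> carrier (tilde S)" "Y \<in> carrier (tilde S)" "Z \<in> carrier (tilde S)"
  shows "X \<preceq>\<^bsub>tilde S\<^esub> Z"
  using assms tilde_join_assoc unfolding le_def by metis

text \<open>What matters is that \<open>tilde_K\<close> is a closure operator on a join semilattice:
  extensivity gives S1, monotonicity with idempotence gives S2, and S3 holds because joins are least
  upper bounds.\<close>

lemma spec_semilattice_tilde: "spec_semilattice (tilde S)"
proof
  fix X Y
  assume XY: "X \<in> carrier (tilde S)" "Y \<in> carrier (tilde S)" "X \<preceq>\<^bsub>tilde S\<^esub> Y"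
  have "Y \<preceq>\<^bsub>tilde S\<^esub> tilde_K S Y"
    using XY by (simp add: le_def join_tilde_K)
  then show "X \<sqsubseteq>\<^bsub>tilde S\<^esub> Y"
    unfolding tilde_spec using XY tilde_le_trans tilde_K_closed by blast
next
  fix X Y Z
  assume XYZ: "X \<in> carrier (tilde S)" "Y \<in> carrier (tilde S)" "Z \<in> carrier (tilde S)"
    and "X \<sqsubseteq>\<^bsub>tilde S\<^esub> Y" "Y \<sqsubseteq>\<^bsub>tilde S\<^esub> Z"
  moreover from this have "tilde_K S Y \<preceq>\<^bsub>tilde S\<^esub> tilde_K S Z"
    using tilde_K_mono[of Y "tilde_K S Z"] by (simp add: tilde_spec tilde_K_closed tilde_K_idem)
  ultimately show "X \<sqsubseteq>\<^bsub>tilde S\<^esub> Z"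
    unfolding tilde_spec using tilde_le_trans tilde_K_closed by blast
next
  fix X Y Z
  assume "X \<in> carrier (tilde S)" "Y \<in> carrier (tilde S)" "Z \<in> carrier (tilde S)"
    "X \<sqsubseteq>\<^bsub>tilde S\<^esub> Y" "Z \<sqsubseteq>\<^bsub>tilde S\<^esub> Y"
  then show "X \<squnion>\<^bsub>tilde S\<^esub> Z \<sqsubseteq>\<^bsub>tilde S\<^esub> Y"
    unfolding tilde_spec le_def using tilde_join_assoc tilde_K_closed by metis
qed (fact tilde_join_closed tilde_join_assoc tilde_join_comm tilde_join_idem)+

text \<open>In \<open>tilde S\<close> the elements \<sqsubseteq> \<open>X\<close> are by definition
  those below \<open>tilde_K S X\<close>, so the maximum is evident. Hence
  \<open>K (tilde S)\<close>, given by a description, agrees with the explicit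
  \<open>tilde_K S\<close>.\<close>

lemma is_closure_tilde:
  assumes "X \<in> carrier (tilde S)"
  shows "is_closure (tilde S) X (tilde_K S X)"
  using assms
  by (simp add: is_closure_def tilde_spec tilde_K_closed spec_semilattice.le_refl[OF spec_semilattice_tilde])

lemma K_tilde: "X \<in> carrier (tilde S) \<Longrightarrow> K (tilde S) X = tilde_K S X"
  using spec_semilattice.K_eqI[OF spec_semilattice_tilde] is_closure_tilde by blast

lemma spec_principal_tilde: "spec_principal (tilde S)"
  using is_closure_tilde unfolding spec_principal_def by blast

lemma spec_additive_tilde: "spec_additive (tilde S)"
  by (simp add: spec_additive_def K_tilde tilde_join_closed tilde_K_join)

lemma spec_semilattice0_tilde: "spec_semilattice0 (tilde S)"
proof (intro spec_semilattice0.intro spec_semilattice0_axioms.intro spec_semilattice_tilde)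
  show zero: "\<zero>\<^bsub>tilde S\<^esub> \<in> carrier (tilde S)"
    by (simp add: tilde_zero tilde_class_in_carrier zero_closed)
  show neutral: "\<zero>\<^bsub>tilde S\<^esub> \<squnion>\<^bsub>tilde S\<^esub> X = X" if "X \<in> carrier (tilde S)" for X
    using that by (auto elim!: tilde_carrierE simp: tilde_zero zero_closed zero_neutral)
  show "X = \<zero>\<^bsub>tilde S\<^esub>" if X: "X \<in> carrier (tilde S)" "X \<sqsubseteq>\<^bsub>tilde S\<^esub> \<zero>\<^bsub>tilde S\<^esub>" for X
  proof -
    \<comment> \<open>Since \<open>K[0, 0] = [0, 0 \<squnion> 0]\<close>, being \<sqsubseteq> zero
      means being below zero.\<close>
    have "tilde_K S \<zero>\<^bsub>tilde S\<^esub> = \<zero>\<^bsub>tilde S\<^esub>"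
      by (simp add: tilde_zero tilde_K_class zero_closed join_idem)
    then have "X \<squnion>\<^bsub>tilde S\<^esub> \<zero>\<^bsub>tilde S\<^esub> = \<zero>\<^bsub>tilde S\<^esub>"
      using X by (simp add: tilde_spec le_def)
    then show ?thesis
      using X zero neutral tilde_join_comm by metis
  qed
qed

section \<open>The embedding \<open>upsilon\<close>\<close>

lemma upsilon_closed: "a \<in> carrier S \<Longrightarrow> upsilon S a \<in> carrier (tilde S)"
  by (simp add: upsilon_def tilde_class_in_carrier zero_closed)

lemma upsilon_spec_iff:
  assumes ab: "a \<in> carrier S" "b \<in> carrier S"
  shows "upsilon S a \<sqsubseteq>\<^bsub>tilde S\<^esub> upsilon S b \<longleftrightarrow> a \<sqsubseteq> b"
proof -
  \<comment> \<open>As \<open>K[b, 0] = [b, b]\<close>, the inequality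
    \<open>[a, 0] \<le> K[b, 0]\<close> reads \<open>[a \<squnion> b, b] = [b, b]\<close>.\<close>
  have "upsilon S a \<sqsubseteq>\<^bsub>tilde S\<^esub> upsilon S b \<longleftrightarrow> tilde_class S (a \<squnion> b) b = tilde_class S b b"
    using ab by (simp add: upsilon_def tilde_spec le_def tilde_K_class zero_closed join_zero
        zero_neutral)
  also have "\<dots> \<longleftrightarrow> ((a \<squnion> b, b), (b, b)) \<in> tilde_rel S"
    using ab by (simp add: tilde_class_eq_iff join_closed)
  also have "\<dots> \<longleftrightarrow> a \<sqsubseteq> b"
  proof
    assume "((a \<squnion> b, b), (b, b)) \<in> tilde_rel S"
    \<comment> \<open>The witness \<open>c\<close> is \<sqsubseteq> \<open>b\<close>, so
      \<open>a\<close> lies below \<open>b \<squnion> c\<close>, which is itself \<sqsubseteq>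
      \<open>b\<close>.\<close>
    then obtain c where c: "c \<in> carrier S" "c \<sqsubseteq> b" "a \<squnion> b \<preceq> b \<squnion> c"
      by (auto simp: tilde_rel_def)
    have "a \<preceq> b \<squnion> c"
      using le_trans[OF le_join1 c(3)] ab c(1) by (simp add: join_closed)
    moreover have "b \<squnion> c \<sqsubseteq> b"
      using ab c by (simp add: S3 spec_refl)
    ultimately show "a \<sqsubseteq> b"
      using S2[OF _ _ _ S1[of a "b \<squnion> c"]] ab c(1) by (simp add: join_closed)
  next
    assume "a \<sqsubseteq> b"
    \<comment> \<open>Here \<open>a\<close> itself is the witness for the first inequality,
      admissible because \<open>a \<sqsubseteq> b\<close>; \<open>b\<close> is the witness for the
      second.\<close>
    moreover have "a \<squnion> b \<preceq> b \<squnion> a" "b \<preceq> (a \<squnion> b) \<squnion> b"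
      using ab join_comm[of a b] by (simp_all add: le_refl le_join2 join_closed)
    ultimately show "((a \<squnion> b, b), (b, b)) \<in> tilde_rel S"
      using ab spec_refl by (auto simp: tilde_rel_def join_closed)
  qed
  finally show ?thesis .
qed

lemma upsilon_hom: "upsilon S \<in> spec_hom S (tilde S)"
  using upsilon_closed upsilon_spec_iff
  by (auto simp: spec_hom_def upsilon_def zero_closed join_idem)

lemma upsilon_zero: "upsilon S \<zero> = \<zero>\<^bsub>tilde S\<^esub>"
  by (simp add: upsilon_def tilde_zero)

text \<open>With second components zero, the witnesses in \<open>tilde_rel\<close> are \<sqsubseteq>
  zero and hence zero, so the relation collapses to the order in both directions.\<close>

lemma upsilon_inj: "inj_on (upsilon S) (carrier S)"
proof (rule inj_onI)
  fix a b assume ab: "a \<in> carrier S" "b \<in> carrier S" "upsilon S a = upsilon S b"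
  then have "((a, \<zero>), (b, \<zero>)) \<in> tilde_rel S"
    by (simp add: upsilon_def tilde_class_eq_iff zero_closed)
  then obtain c d where "c \<in> carrier S" "d \<in> carrier S" "c \<sqsubseteq> \<zero>" "d \<sqsubseteq> \<zero>" "a \<preceq> b \<squnion> d" "b \<preceq> a \<squnion> c"
    unfolding tilde_rel_def by auto
  then have "a \<preceq> b" "b \<preceq> a"
    using ab spec_zero join_zero by metis+
  then show "a = b"
    using ab le_antisym by blast
qed

lemma upsilon_embedding: "upsilon S \<in> spec_embedding S (tilde S)"
  using upsilon_hom upsilon_inj upsilon_spec_iff by (simp add: spec_embedding_def)

lemma upsilon_hom0: "upsilon S \<in> spec_hom0 S (tilde S)"
  using upsilon_hom upsilon_zero by (simp add: spec_hom0_def)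

text \<open>Every class is thus built from values of \<open>upsilon\<close> by join and
  \<open>K\<close>, which forces uniqueness of the extension. The right side computes to
  \<open>[a \<squnion> b, b]\<close>.\<close>

lemma tilde_class_eq_upsilon:
  assumes "a \<in> carrier S" "b \<in> carrier S"
  shows "tilde_class S a b = upsilon S a \<squnion>\<^bsub>tilde S\<^esub> K (tilde S) (upsilon S b)"
proof -
  \<comment> \<open>Both witnesses are \<open>b\<close>: first components are compared only up to
    elements \<sqsubseteq> \<open>b\<close>.\<close>
  have "((a, b), (a \<squnion> b, b)) \<in> tilde_rel S"
    unfolding tilde_rel_def
    using assms spec_refl[of b] le_refl[of "a \<squnion> b"] le_join1[of a "b \<squnion> b"]
    by (auto simp: join_closed join_assoc intro!: bexI[of _ b])
  then show ?thesis
    using assms by (simp add: K_tilde upsilon_closed)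
      (simp add: upsilon_def tilde_K_class zero_closed join_zero zero_neutral tilde_class_eq_iff join_closed)
qed

end

section \<open>Lifting a homomorphism to \<open>tilde S\<close>, and the universal property\<close>

definition tilde_lift ::
    "('a, 'm) spec_struct0_scheme \<Rightarrow> ('b, 'n) spec_struct_scheme \<Rightarrow> ('a \<Rightarrow> 'b) \<Rightarrow> ('a \<times> 'a) set \<Rightarrow> 'b"
  where "tilde_lift S T h =
    (\<lambda>X \<in> carrier (tilde S). the_elem (\<Union>(a, b) \<in> X. {h a \<squnion>\<^bsub>T\<^esub> K T (h b)}))"

locale additive_spec_hom =
  S: spec_semilattice0 S + T: principal_spec_semilattice T for S (structure) and T (structure) +
  fixes h
  assumes additive: "spec_additive T"
    and hom: "h \<in> spec_hom S T"
begin

text \<open>Half of \<open>tilde_rel\<close> suffices for one inequality. The witness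
  \<open>e\<close> with \<open>e \<sqsubseteq> d\<close> is absorbed because \<open>h e\<close> is
  below \<open>K T (h d)\<close>, and \<open>b \<sqsubseteq> d\<close> puts \<open>K T (h b)\<close>
  below \<open>K T (h d)\<close>.\<close>

lemma lift_le:
  assumes "((a, b), (c, d)) \<in> tilde_rel S"
  shows "h a \<squnion>\<^bsub>T\<^esub> K T (h b) \<preceq>\<^bsub>T\<^esub> h c \<squnion>\<^bsub>T\<^esub> K T (h d)"
proof -
  from assms obtain e where e: "e \<in> carrier S" "e \<sqsubseteq>\<^bsub>S\<^esub> d" "a \<preceq>\<^bsub>S\<^esub> c \<squnion>\<^bsub>S\<^esub> e" "b \<sqsubseteq>\<^bsub>S\<^esub> d"
    and S: "a \<in> carrier S" "b \<in> carrier S" "c \<in> carrier S" "d \<in> carrier S"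
    unfolding tilde_rel_def by auto
  note T = spec_homD(1)[OF hom]
  have "h a \<preceq>\<^bsub>T\<^esub> h c \<squnion>\<^bsub>T\<^esub> h e"
    using spec_homD(4)[OF hom _ _ e(3)] e S by (simp add: S.join_closed spec_homD(2)[OF hom])
  moreover have "h e \<preceq>\<^bsub>T\<^esub> K T (h d)"
    using spec_homD(3)[OF hom _ _ e(2)] e S T by (simp add: T.spec_iff_le_K)
  then have "h c \<squnion>\<^bsub>T\<^esub> h e \<preceq>\<^bsub>T\<^esub> h c \<squnion>\<^bsub>T\<^esub> K T (h d)"
    using e S T by (simp add: T.join_mono T.le_refl T.K_closed)
  ultimately have "h a \<preceq>\<^bsub>T\<^esub> h c \<squnion>\<^bsub>T\<^esub> K T (h d)"
    using T.le_trans e S T T.K_closed T.join_closed by meson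
  moreover have "K T (h b) \<preceq>\<^bsub>T\<^esub> h c \<squnion>\<^bsub>T\<^esub> K T (h d)"
    using T.le_trans[OF T.K_mono T.le_join2] spec_homD(3)[OF hom _ _ e(4)] S T
    by (simp add: T.K_closed T.join_closed)
  ultimately show ?thesis
    using S T by (simp add: T.join_lub T.K_closed T.join_closed)
qed

text \<open>The \<open>the_elem\<close> in \<open>tilde_lift\<close> yields this value because all
  representatives agree: \<open>lift_le\<close> applies both ways by symmetry of
  \<open>tilde_rel\<close>.\<close>

lemma lift_class:
  assumes "a \<in> carrier S" "b \<in> carrier S"
  shows "tilde_lift S T h (tilde_class S a b) = h a \<squnion>\<^bsub>T\<^esub> K T (h b)"
proof -
  have "h (fst p) \<squnion>\<^bsub>T\<^esub> K T (h (snd p)) = h a \<squnion>\<^bsub>T\<^esub> K T (h b)" if "p \<in> tilde_class S a b" for p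
  proof -
    have 1: "((a, b), (fst p, snd p)) \<in> tilde_rel S"
      using that by (rule S.tilde_class_rel)
    then have 2: "((fst p, snd p), (a, b)) \<in> tilde_rel S"
      using S.equiv_tilde_rel by (meson equivE symE)
    have "fst p \<in> carrier S" "snd p \<in> carrier S"
      using 1 by (auto simp: tilde_rel_def)
    then show ?thesis
      using T.le_antisym[OF lift_le[OF 2] lift_le[OF 1]] assms
      by (simp add: T.join_closed T.K_closed spec_homD(1)[OF hom])
  qed
  moreover have "tilde_class S a b \<noteq> {}"
    using S.tilde_class_self assms by blast
  ultimately have "(\<Union>p \<in> tilde_class S a b. {h (fst p) \<squnion>\<^bsub>T\<^esub> K T (h (snd p))})
      = {h a \<squnion>\<^bsub>T\<^esub> K T (h b)}"
    by simp
  then show ?thesis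
    using assms by (simp add: tilde_lift_def S.tilde_class_in_carrier case_prod_unfold)
qed

lemma K_T_join:
  "\<lbrakk>x \<in> carrier T; y \<in> carrier T\<rbrakk> \<Longrightarrow> K T (x \<squnion>\<^bsub>T\<^esub> y) = K T x \<squnion>\<^bsub>T\<^esub> K T y"
  using additive by (simp add: spec_additive_def)

lemma lift_closed: "X \<in> carrier (tilde S) \<Longrightarrow> tilde_lift S T h X \<in> carrier T"
  by (auto elim!: S.tilde_carrierE simp: lift_class T.join_closed T.K_closed spec_homD(1)[OF hom])

text \<open>Additivity of \<open>T\<close> splits the closure of the joined second components; the
  rest is rearrangement of four terms.\<close>

lemma lift_join:
  assumes "X \<in> carrier (tilde S)" "Y \<in> carrier (tilde S)"
  shows "tilde_lift S T h (X \<squnion>\<^bsub>tilde S\<^esub> Y) = tilde_lift S T h X \<squnion>\<^bsub>T\<^esub> tilde_lift S T h Y"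
  using assms
  by (auto elim!: S.tilde_carrierE simp: lift_class S.join_closed spec_homD(1,2)[OF hom] K_T_join
      T.K_closed T.join_swap)

lemma lift_K:
  assumes "X \<in> carrier (tilde S)"
  shows "tilde_lift S T h (K (tilde S) X) = K T (tilde_lift S T h X)"
proof -
  obtain a b where X: "X = tilde_class S a b" "a \<in> carrier S" "b \<in> carrier S"
    using assms by (rule S.tilde_carrierE)
  have T: "h a \<in> carrier T" "h b \<in> carrier T"
    using X spec_homD(1)[OF hom] by auto
  have "tilde_lift S T h (K (tilde S) X) = h a \<squnion>\<^bsub>T\<^esub> (K T (h a) \<squnion>\<^bsub>T\<^esub> K T (h b))"
    using X T assms by (simp add: S.K_tilde S.tilde_K_class lift_class S.join_closed
        spec_homD(2)[OF hom] K_T_join)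
  \<comment> \<open>The term \<open>h a\<close> is absorbed by its closure.\<close>
  also have "\<dots> = K T (h a) \<squnion>\<^bsub>T\<^esub> K T (h b)"
    using T T.le_K[of "h a"] by (simp add: T.join_assoc[symmetric] T.K_closed le_def)
  \<comment> \<open>Additivity splits \<open>K T (h a \<squnion> K T (h b))\<close>, and idempotence
    removes the double closure.\<close>
  also have "\<dots> = K T (tilde_lift S T h X)"
    using X T by (simp add: lift_class K_T_join T.K_closed T.K_K)
  finally show ?thesis .
qed

text \<open>In \<open>tilde S\<close>, \<open>X \<sqsubseteq> Y\<close> is an equation between joins
  and closures, so preservation of \<sqsubseteq> follows from that of join and
  \<open>K\<close>.\<close>

lemma lift_K_hom: "tilde_lift S T h \<in> K_hom (tilde S) T"
proof -
  have "tilde_lift S T h X \<sqsubseteq>\<^bsub>T\<^esub> tilde_lift S T h Y"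
    if XY: "X \<in> carrier (tilde S)" "Y \<in> carrier (tilde S)" "X \<sqsubseteq>\<^bsub>tilde S\<^esub> Y" for X Y
  proof -
    have KY: "K (tilde S) Y \<in> carrier (tilde S)"
      using XY by (simp add: S.K_tilde S.tilde_K_closed)
    have "X \<squnion>\<^bsub>tilde S\<^esub> K (tilde S) Y = K (tilde S) Y"
      using XY by (simp add: S.tilde_spec S.K_tilde le_def)
    then have "tilde_lift S T h X \<preceq>\<^bsub>T\<^esub> K T (tilde_lift S T h Y)"
      using lift_join[OF XY(1) KY] XY by (simp add: lift_K le_def)
    then show ?thesis
      using XY by (simp add: T.spec_iff_le_K lift_closed)
  qed
  then show ?thesis
    by (auto simp: K_hom_def spec_hom_def lift_closed lift_join lift_K)
qed

end

text \<open>The type of \<open>T\<close> is left free, so that the result also applies to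
  \<open>tilde U\<close>, whose elements are sets of pairs.\<close>

lemma (in spec_semilattice0) tilde_universal:
  assumes "spec_semilattice0 T" "spec_principal T" "spec_additive T" "h \<in> spec_hom0 S T"
  shows "\<exists>!g. g \<in> extensional (carrier (tilde S)) \<and> g \<in> K_hom (tilde S) T \<and>
    (\<forall>a \<in> carrier S. g (upsilon S a) = h a)"
proof -
  interpret T: spec_semilattice0 T by fact
  have hom: "h \<in> spec_hom S T" and h0: "h \<zero> = \<zero>\<^bsub>T\<^esub>"
    using assms(4) by (auto simp: spec_hom0_def)
  interpret additive_spec_hom S T h
    by unfold_locales (use assms hom in auto)
  \<comment> \<open>On \<open>[a, 0]\<close> the lift gives \<open>h a \<squnion> K T (h 0)\<close>.
    Preservation of zero and \<open>K_zero\<close> in \<open>T\<close> reduce this to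
    \<open>h a\<close>.\<close>
  have "tilde_lift S T h (upsilon S a) = h a" if "a \<in> carrier S" for a
    using that by (simp add: upsilon_def lift_class zero_closed h0 T.K_zero T.join_zero
        spec_homD(1)[OF hom])
  moreover have "g = tilde_lift S T h"
    if g: "g \<in> extensional (carrier (tilde S))" "g \<in> K_hom (tilde S) T"
      "\<forall>a \<in> carrier S. g (upsilon S a) = h a" for g
  proof (rule extensionalityI[OF g(1)])
    \<comment> \<open>The lift is a restricted function, so it and \<open>g\<close> are both
      \<open>undefined\<close> off the carrier and only classes remain to be compared.\<close>
    show "tilde_lift S T h \<in> extensional (carrier (tilde S))"
      by (simp add: tilde_lift_def)
    fix X assume "X \<in> carrier (tilde S)"
    then obtain a b where X: "X = tilde_class S a b" "a \<in> carrier S" "b \<in> carrier S"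
      by (rule tilde_carrierE)
    have "g X = g (upsilon S a \<squnion>\<^bsub>tilde S\<^esub> K (tilde S) (upsilon S b))"
      using X by (simp add: tilde_class_eq_upsilon)
    also have "\<dots> = h a \<squnion>\<^bsub>T\<^esub> K T (h b)"
      \<comment> \<open>Reading \<open>K_tilde\<close> backwards turns closedness under
        \<open>tilde_K\<close> into membership of \<open>K (tilde S) (upsilon S b)\<close> in the
        carrier, as join preservation by \<open>g\<close> requires.\<close>
      using g(2,3) X(2,3) tilde_K_closed[of "upsilon S b"]
      by (simp add: K_hom_def spec_hom_def upsilon_closed flip: K_tilde)
    finally show "g X = tilde_lift S T h X"
      using X by (simp add: lift_class)
  qed
  ultimately show ?thesis
    using lift_K_hom by (intro ex1I[of _ "tilde_lift S T h"]) (auto simp: tilde_lift_def)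
qed

theorem theorem3p2:
  fixes S :: "'s spec_struct0"
  assumes "spec_semilattice0 S"
  shows "(spec_semilattice0 (tilde S) \<and> spec_principal (tilde S) \<and> spec_additive (tilde S))
    \<and> upsilon S \<in> spec_embedding S (tilde S) \<inter> spec_hom0 S (tilde S)
    \<and> (\<forall>(T :: 't spec_struct0) \<eta>.
         spec_semilattice0 T \<and> spec_principal T \<and> spec_additive T \<and> \<eta> \<in> spec_hom0 S T \<longrightarrow>
         (\<exists>!\<eta>'. \<eta>' \<in> extensional (carrier (tilde S)) \<and> \<eta>' \<in> K_hom (tilde S) T \<and>
            (\<forall>a \<in> carrier S. \<eta>' (upsilon S a) = \<eta> a)))
    \<and> (\<forall>(U :: 'u spec_struct0) \<psi>.
         spec_semilattice0 U \<and> \<psi> \<in> spec_hom0 S U \<longrightarrow>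
         (\<exists>!\<psi>'. \<psi>' \<in> extensional (carrier (tilde S)) \<and> \<psi>' \<in> K_hom (tilde S) (tilde U) \<and>
            (\<forall>a \<in> carrier S. \<psi>' (upsilon S a) = upsilon U (\<psi> a))))"
proof (intro conjI IntI allI impI)
  interpret spec_semilattice0 S by fact
  show "spec_semilattice0 (tilde S)" "spec_principal (tilde S)" "spec_additive (tilde S)"
    by (rule spec_semilattice0_tilde spec_principal_tilde spec_additive_tilde)+
  show "upsilon S \<in> spec_embedding S (tilde S)" "upsilon S \<in> spec_hom0 S (tilde S)"
    by (rule upsilon_embedding upsilon_hom0)+
  fix T :: "'t spec_struct0" and \<eta>
  assume "spec_semilattice0 T \<and> spec_principal T \<and> spec_additive T \<and> \<eta> \<in> spec_hom0 S T"
  then show "\<exists>!\<eta>'. \<eta>' \<in> extensional (carrier (tilde S)) \<and> \<eta>' \<in> K_hom (tilde S) T \<and>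
      (\<forall>a \<in> carrier S. \<eta>' (upsilon S a) = \<eta> a)"
    using tilde_universal by blast
next
  interpret spec_semilattice0 S by fact
  fix U :: "'u spec_struct0" and \<psi>
  assume U: "spec_semilattice0 U \<and> \<psi> \<in> spec_hom0 S U"
  then interpret U: spec_semilattice0 U by blast
  \<comment> \<open>The target \<open>tilde U\<close> is again principal and additive with zero, so
    this composite is an admissible input to the universal property.\<close>
  have "(\<lambda>a. upsilon U (\<psi> a)) \<in> spec_hom0 S (tilde U)"
    using U U.upsilon_hom0 spec_hom_comp by (auto simp: spec_hom0_def)
  then show "\<exists>!\<psi>'. \<psi>' \<in> extensional (carrier (tilde S)) \<and> \<psi>' \<in> K_hom (tilde S) (tilde U) \<and>
      (\<forall>a \<in> carrier S. \<psi>' (upsilon S a) = upsilon U (\<psi> a))"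
    by (intro tilde_universal U.spec_semilattice0_tilde U.spec_principal_tilde
        U.spec_additive_tilde)
qed

end
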